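(* Let $D\subset\mathbb{R}^m$ and $E\subset\mathbb{R}^r$ be compact sets with Lipschitz boundaries and let $\delta>0$. The in-context conditioning operator $\Psi^\star:\mathcal{X}_\delta\times E\to C(D)$, $\Psi^\star(\rho,y)=\rho(\cdot\,|\,y)$, is continuous, where $\mathcal{X}_\delta\times E$ carries the metric induced by the norm $\|(\rho,y)\|_{C(D\times E)\times E}=\max(\|\rho\|_{C(D\times E)},\|y\|)$ and $C(D)$ carries the supremum norm.
   Context: $\|y\|$ is the Euclidean norm on $\mathbb{R}^r$; $C(\cdot)$ carries the supremum norm. $C_{\mathrm{ac}}(D\times E)$ is the set of $\rho\in C(D\times E)$ with $\rho\ge0$ and $\int_{D\times E}\rho(z)\,dz=1$. For such $\rho$, $m_\rho(y)=\int_D\rho(x,y)\,dx$ for $y\in E$. $\mathcal{X}_\delta=\{\rho\in C_{\mathrm{ac}}(D\times E):\inf_{y\in E}m_\rho(y)\ge\delta\}$. The conditional density is $\rho(x\,|\,y)=\rho(x,y)/m_\rho(y)$. *)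

theory Defs
  imports "HOL-Analysis.Analysis"
begin

section \<open>Sets with Lipschitz boundary\<close>

text \<open>
  Near each boundary point, and after a rotation, the set is the epigraph of a Lipschitz function
  of the remaining coordinates. The definition is coordinate-free: the unit vector \<open>e\<close> is the
  distinguished axis, \<open>x \<bullet> e\<close> is the coordinate along it, and \<open>x - (x \<bullet> e) *\<^sub>R e\<close> is the
  orthogonal projection to the hyperplane perpendicular to \<open>e\<close>. The inequality is non-strict
  because the definition is meant for closed sets.
\<close>

definition lipschitz_boundary :: "'a::euclidean_space set \<Rightarrow> bool" where
  "lipschitz_boundary S \<longleftrightarrow>
     (\<forall>p \<in> frontier S. \<exists>r > 0. \<exists>e. \<exists>\<phi> :: 'a \<Rightarrow> real. \<exists>L.
        norm e = 1 \<and> L-lipschitz_on {v. v \<bullet> e = 0} \<phi> \<and>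
        S \<inter> ball p r = {x \<in> ball p r. \<phi> (x - (x \<bullet> e) *\<^sub>R e) \<le> x \<bullet> e})"


section \<open>Function spaces and the product metric\<close>

text \<open>
  The library space of bounded continuous functions on a topological space with the supremum
  metric. Its elements are extensional, i.e. \<open>undefined\<close> outside \<open>S\<close>. For compact \<open>S\<close>
  the boundedness is automatic.
\<close>

definition C_space :: "'a::topological_space set \<Rightarrow> ('a \<Rightarrow> real) metric" where
  "C_space S = cfunspace (top_of_set S) euclidean_metric"

lemma mspace_C_space:
  assumes "compact S"
  shows "mspace (C_space S) = {f \<in> extensional S. continuous_on S f}"
proof -
  have "Met_TC.mbounded (f ` S)" if "continuous_on S f" for f :: "'a \<Rightarrow> real"
    using compact_imp_bounded[OF compact_continuous_image[OF that assms]]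
    by (simp add: mbounded_iff_bounded)
  then show ?thesis
    by (auto simp: C_space_def Met_TC.fspace_def)
qed

lemma mdist_C_space:
  assumes "f \<in> mspace (C_space S)" "g \<in> mspace (C_space S)" "S \<noteq> {}"
  shows "mdist (C_space S) f g = (SUP x\<in>S. \<bar>f x - g x\<bar>)"
  using assms
  by (auto simp: C_space_def mdist_cfunspace_eq_mdist_funspace Met_TC.fdist_def Met_TC.fspace_def dist_real_def)

text \<open>The library's \<open>prod_metric\<close> is the Euclidean combination of the factors; this is the maximum.\<close>

definition max_metric :: "'a metric \<Rightarrow> 'b metric \<Rightarrow> ('a \<times> 'b) metric" where
  "max_metric m1 m2 =
     metric (mspace m1 \<times> mspace m2,
             \<lambda>(x, y) (x', y'). max (mdist m1 x x') (mdist m2 y y'))"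

lemma Metric_space_max:
  "Metric_space (mspace m1 \<times> mspace m2)
     (\<lambda>(x, y) (x', y'). max (mdist m1 x x') (mdist m2 y y'))"
proof
  fix p q :: "'a \<times> 'b"
  show "0 \<le> (\<lambda>(x, y) (x', y'). max (mdist m1 x x') (mdist m2 y y')) p q"
    by (auto split: prod.splits simp: le_max_iff_disj)
  show "(\<lambda>(x, y) (x', y'). max (mdist m1 x x') (mdist m2 y y')) p q =
        (\<lambda>(x, y) (x', y'). max (mdist m1 x x') (mdist m2 y y')) q p"
    by (auto split: prod.splits simp: mdist_commute)
next
  fix p q assume "p \<in> mspace m1 \<times> mspace m2" "q \<in> mspace m1 \<times> mspace m2"
  then show "(\<lambda>(x, y) (x', y'). max (mdist m1 x x') (mdist m2 y y')) p q = 0 \<longleftrightarrow> p = q"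
    by (auto simp: max_def split: if_splits)
       (metis mdist_nonneg mdist_zero order_antisym nle_le)+
next
  fix p q r
  assume "p \<in> mspace m1 \<times> mspace m2" "q \<in> mspace m1 \<times> mspace m2" "r \<in> mspace m1 \<times> mspace m2"
  then obtain a b a' b' a'' b'' where eqs: "p = (a, b)" "q = (a', b')" "r = (a'', b'')"
    and mem: "a \<in> mspace m1" "a' \<in> mspace m1" "a'' \<in> mspace m1"
             "b \<in> mspace m2" "b' \<in> mspace m2" "b'' \<in> mspace m2"
    by auto
  have "mdist m1 a a'' \<le> mdist m1 a a' + mdist m1 a' a''"
       "mdist m2 b b'' \<le> mdist m2 b b' + mdist m2 b' b''"
    using mem by (auto intro: mdist_triangle)
  then show "(\<lambda>(x, y) (x', y'). max (mdist m1 x x') (mdist m2 y y')) p r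
      \<le> (\<lambda>(x, y) (x', y'). max (mdist m1 x x') (mdist m2 y y')) p q
        + (\<lambda>(x, y) (x', y'). max (mdist m1 x x') (mdist m2 y y')) q r"
    unfolding eqs by (auto simp: max_def)
qed

lemma mspace_max_metric [simp]: "mspace (max_metric m1 m2) = mspace m1 \<times> mspace m2"
  unfolding max_metric_def by (rule Metric_space.mspace_metric[OF Metric_space_max])

lemma mdist_max_metric [simp]:
  "mdist (max_metric m1 m2) (x, y) (x', y') = max (mdist m1 x x') (mdist m2 y y')"
  unfolding max_metric_def by (simp add: Metric_space.mdist_metric[OF Metric_space_max])


section \<open>Densities, marginals and conditioning\<close>

definition C_ac :: "'a::euclidean_space set \<Rightarrow> ('a \<Rightarrow> real) set" where
  "C_ac S = {\<rho> \<in> mspace (C_space S). (\<forall>z\<in>S. 0 \<le> \<rho> z) \<and> (LINT z:S|lborel. \<rho> z) = 1}"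

definition marginal :: "'a::euclidean_space set \<Rightarrow> ('a \<times> 'b \<Rightarrow> real) \<Rightarrow> 'b \<Rightarrow> real" where
  "marginal D \<rho> y = (LINT x:D|lborel. \<rho> (x, y))"

text \<open>
  \<open>E\<close> is nonempty whenever \<open>C_ac (D \<times> E)\<close> is, and the marginal of a nonnegative density is
  nonnegative, so the real infimum below is never taken over an empty set or one unbounded below.
\<close>

definition X_set ::
  "'a::euclidean_space set \<Rightarrow> 'b::euclidean_space set \<Rightarrow> real \<Rightarrow> ('a \<times> 'b \<Rightarrow> real) set" where
  "X_set D E \<delta> = {\<rho> \<in> C_ac (D \<times> E). (INF y\<in>E. marginal D \<rho> y) \<ge> \<delta>}"

definition cond_density ::
  "'a::euclidean_space set \<Rightarrow> ('a \<times> 'b \<Rightarrow> real) \<Rightarrow> 'a \<Rightarrow> 'b \<Rightarrow> real" where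
  "cond_density D \<rho> x y = \<rho> (x, y) / marginal D \<rho> y"

definition conditioning ::
  "'a::euclidean_space set \<Rightarrow> ('a \<times> 'b \<Rightarrow> real) \<times> 'b \<Rightarrow> ('a \<Rightarrow> real)" where
  "conditioning D = (\<lambda>(\<rho>, y). \<lambda>x\<in>D. cond_density D \<rho> x y)"

end

theory Submission
  imports Defs
begin

text \<open>
  If \<open>(\<rho>', y')\<close> is close to \<open>(\<rho>, y)\<close>, then \<open>\<rho>' (x, y')\<close> is close to \<open>\<rho> (x, y)\<close> uniformly
  in \<open>x \<in> D\<close>, because \<open>\<rho>\<close> is uniformly continuous on the compact set \<open>D \<times> E\<close>. Integrating over \<open>D\<close>,
  which has finite measure, makes the marginals close as well. Both marginals are at least \<open>\<delta>\<close>, so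
  the quotients are uniformly close.
\<close>

lemma set_integrable_compact:
  fixes f :: "'a::euclidean_space \<Rightarrow> real"
  assumes "compact S" "continuous_on S f"
  shows "set_integrable lborel S f"
  unfolding set_integrable_def using assms by (rule borel_integrable_compact)

text \<open>The integrand \<open>f x - g x\<close> lies between the constants
  \<open>- \<eta>\<close> and \<open>\<eta>\<close>, and a compact set has finite Lebesgue measure,
  so monotonicity of the integral gives both bounds. This is what turns uniform closeness of slices
  into closeness of marginals.\<close>

lemma set_integral_compact_diff_le:
  fixes f g :: "'a::euclidean_space \<Rightarrow> real"
  assumes S: "compact S" and f: "continuous_on S f" and g: "continuous_on S g"
    and le: "\<And>x. x \<in> S \<Longrightarrow> \<bar>f x - g x\<bar> \<le> \<eta>"
  shows "\<bar>(LINT x:S|lborel. f x) - (LINT x:S|lborel. g x)\<bar> \<le> measure lborel S * \<eta>"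
proof -
  have fin: "S \<in> sets lborel" "emeasure lborel S \<noteq> \<infinity>"
    using S emeasure_bounded_finite[OF compact_imp_bounded[OF S]]
    by (auto simp: borel_compact)
  have int: "set_integrable lborel S f" "set_integrable lborel S g"
    "\<And>c::real. set_integrable lborel S (\<lambda>_. c)"
    using S f g by (auto intro!: set_integrable_compact)
  have const: "(LINT x:S|lborel. c) = measure lborel S * c" for c :: real
    using set_integral_const[OF fin, of c] by simp
  have diff: "(LINT x:S|lborel. f x - g x) = (LINT x:S|lborel. f x) - (LINT x:S|lborel. g x)"
    using int by (intro set_integral_diff)
  have "(LINT x:S|lborel. f x - g x) \<le> (LINT x:S|lborel. \<eta>)"
    using le by (intro set_integral_mono set_integral_diff int) (auto simp: abs_le_iff)
  moreover have "(LINT x:S|lborel. - \<eta>) \<le> (LINT x:S|lborel. f x - g x)"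
    using le by (intro set_integral_mono set_integral_diff int) (fastforce simp: abs_le_iff)
  ultimately show ?thesis
    by (simp add: diff const abs_le_iff)
qed

text \<open>Adding and subtracting \<open>a / m'\<close> splits the difference into a change of
  numerator and a change of denominator. In this splitting only the unprimed numerator needs a bound
  \<open>B\<close>, so the resulting factor does not depend on the perturbed values.\<close>

lemma abs_divide_diff_le:
  fixes a a' m m' :: real
  assumes "\<delta> > 0" "\<delta> \<le> m" "\<delta> \<le> m'" "\<bar>a\<bar> \<le> B"
    and a: "\<bar>a' - a\<bar> \<le> \<eta>" and m: "\<bar>m' - m\<bar> \<le> M * \<eta>"
  shows "\<bar>a' / m' - a / m\<bar> \<le> \<eta> * (1 / \<delta> + B * M / \<delta>\<^sup>2)"
proof -
  have "\<delta> * \<delta> \<le> m' * m"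
    using assms by (intro mult_mono) auto
  \<comment> \<open>The last three signs are forced by the upper bounds on absolute values.\<close>
  moreover have "0 < m' * m" "0 \<le> \<eta>" "0 \<le> B" "0 \<le> M * \<eta>"
    using assms by auto
  ultimately have
    "\<bar>a' - a\<bar> / m' + \<bar>a\<bar> * \<bar>m' - m\<bar> / (m' * m) \<le> \<eta> / \<delta> + B * (M * \<eta>) / (\<delta> * \<delta>)"
    using assms by (intro add_mono frac_le mult_mono) auto
  moreover have "a' / m' - a / m = (a' - a) / m' - a * (m' - m) / (m' * m)"
    using assms by (simp add: field_simps)
  then have "\<bar>a' / m' - a / m\<bar> \<le> \<bar>(a' - a) / m'\<bar> + \<bar>a * (m' - m) / (m' * m)\<bar>"
    by linarith
  then have "\<bar>a' / m' - a / m\<bar> \<le> \<bar>a' - a\<bar> / m' + \<bar>a\<bar> * \<bar>m' - m\<bar> / (m' * m)"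
    using assms by (simp add: abs_mult abs_divide)
  ultimately show ?thesis
    by (simp add: algebra_simps power2_eq_square)
qed

lemma continuous_on_slice:
  assumes "continuous_on (D \<times> E) \<rho>" "y \<in> E"
  shows "continuous_on D (\<lambda>x. \<rho> (x, y))"
  using assms(2) by (intro continuous_on_compose2[OF assms(1)] continuous_intros) auto

lemma X_setD:
  fixes D :: "'a::euclidean_space set" and E :: "'b::euclidean_space set"
  assumes D: "compact D" and E: "compact E" and \<rho>: "\<rho> \<in> X_set D E \<delta>"
  shows "\<rho> \<in> mspace (C_space (D \<times> E))" "continuous_on (D \<times> E) \<rho>" "D \<times> E \<noteq> {}"
    "\<And>y. y \<in> E \<Longrightarrow> \<delta> \<le> marginal D \<rho> y"
proof -
  have ac: "\<rho> \<in> C_ac (D \<times> E)" and inf: "\<delta> \<le> (INF y\<in>E. marginal D \<rho> y)"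
    using \<rho> by (auto simp: X_set_def)
  show "\<rho> \<in> mspace (C_space (D \<times> E))"
    using ac by (simp add: C_ac_def)
  then show "continuous_on (D \<times> E) \<rho>"
    using mspace_C_space[OF compact_Times[OF D E]] by auto
  \<comment> \<open>Over the empty set the integral would be 0 instead of 1.\<close>
  show "D \<times> E \<noteq> {}"
    using ac by (auto simp: C_ac_def set_lebesgue_integral_def)
  show "\<delta> \<le> marginal D \<rho> y" if y: "y \<in> E" for y
  proof -
    \<comment> \<open>A real \<open>INF\<close> is a lower bound of the values only if these are
      bounded below; nonnegativity of the density supplies the bound 0.\<close>
    have "0 \<le> marginal D \<rho> y" if "y \<in> E" for y
      using ac that unfolding marginal_def set_lebesgue_integral_def
      by (intro Bochner_Integration.integral_nonneg) (auto simp: C_ac_def indicator_def)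
    then have "bdd_below (marginal D \<rho> ` E)"
      by (intro bdd_belowI2[where m = 0])
    then show ?thesis
      using inf cINF_lower[OF _ y, of "marginal D \<rho>"] by linarith
  qed
qed

text \<open>Compactness makes the set of differences bounded above, without which the real
  \<open>SUP\<close> need not dominate its members.\<close>

lemma abs_diff_le_mdist_C_space:
  assumes "compact S" "f \<in> mspace (C_space S)" "g \<in> mspace (C_space S)" "x \<in> S"
  shows "\<bar>f x - g x\<bar> \<le> mdist (C_space S) f g"
proof -
  have "continuous_on S f" "continuous_on S g"
    using assms by (auto simp: mspace_C_space)
  then have "compact ((\<lambda>x. \<bar>f x - g x\<bar>) ` S)"
    using assms(1) by (intro compact_continuous_image continuous_intros)
  then have "bdd_above ((\<lambda>x. \<bar>f x - g x\<bar>) ` S)"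
    by (intro bounded_imp_bdd_above compact_imp_bounded)
  moreover have "mdist (C_space S) f g = (SUP x\<in>S. \<bar>f x - g x\<bar>)"
    using assms by (intro mdist_C_space) auto
  ultimately show ?thesis
    using assms(4) by (auto intro: cSUP_upper)
qed

lemma mdist_C_space_le:
  assumes "f \<in> mspace (C_space S)" "g \<in> mspace (C_space S)" "S \<noteq> {}"
    and "\<And>x. x \<in> S \<Longrightarrow> \<bar>f x - g x\<bar> \<le> c"
  shows "mdist (C_space S) f g \<le> c"
  using assms by (auto simp: mdist_C_space intro: cSUP_least)

text \<open>For fixed \<open>y\<close> the denominator is a constant in \<open>x\<close>, nonzero
  because it is at least \<open>\<delta>\<close>; the numerator is a slice of a continuous
  function.\<close>

lemma conditioning_in_C_space:
  fixes D :: "'a::euclidean_space set" and E :: "'b::euclidean_space set"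
  assumes "compact D" "compact E" "\<delta> > 0" "\<rho> \<in> X_set D E \<delta>" "y \<in> E"
  shows "conditioning D (\<rho>, y) \<in> mspace (C_space D)"
proof -
  have "marginal D \<rho> y \<noteq> 0"
    using X_setD(4)[OF assms(1,2,4,5)] \<open>\<delta> > 0\<close> by auto
  then have "continuous_on D (\<lambda>x. cond_density D \<rho> x y)"
    unfolding cond_density_def
    by (intro continuous_intros continuous_on_slice[OF X_setD(2)[OF assms(1,2,4)] \<open>y \<in> E\<close>]) auto
  then have "continuous_on D (conditioning D (\<rho>, y))"
    by (rule continuous_on_eq) (simp add: conditioning_def)
  then show ?thesis
    using \<open>compact D\<close> by (simp add: mspace_C_space conditioning_def)
qed

text \<open>The quantitative core: the distance of the conditionals is at most a factor times the
  distance \<open>\<eta>\<close> of the slices. Since \<open>B\<close> bounds the slice at the base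
  point alone, the factor is the same for all \<open>(\<rho>', y')\<close>.\<close>

lemma mdist_conditioning_le:
  fixes D :: "'a::euclidean_space set" and E :: "'b::euclidean_space set"
  assumes D: "compact D" and E: "compact E" and "\<delta> > 0"
    and \<rho>: "\<rho> \<in> X_set D E \<delta>" and \<rho>': "\<rho>' \<in> X_set D E \<delta>" and y: "y \<in> E" and y': "y' \<in> E"
    and bound: "\<And>x. x \<in> D \<Longrightarrow> \<bar>\<rho> (x, y)\<bar> \<le> B"
    and close: "\<And>x. x \<in> D \<Longrightarrow> \<bar>\<rho>' (x, y') - \<rho> (x, y)\<bar> \<le> \<eta>"
  shows "mdist (C_space D) (conditioning D (\<rho>, y)) (conditioning D (\<rho>', y'))
    \<le> \<eta> * (1 / \<delta> + B * measure lborel D / \<delta>\<^sup>2)"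
proof (rule mdist_C_space_le)
  show "conditioning D (\<rho>, y) \<in> mspace (C_space D)" "conditioning D (\<rho>', y') \<in> mspace (C_space D)"
    using assms by (auto intro: conditioning_in_C_space)
  show "D \<noteq> {}"
    using X_setD(3)[OF D E \<rho>] by auto
  fix x assume x: "x \<in> D"
  have "\<bar>marginal D \<rho>' y' - marginal D \<rho> y\<bar> \<le> measure lborel D * \<eta>"
    unfolding marginal_def using close
    by (intro set_integral_compact_diff_le D
        continuous_on_slice[OF X_setD(2)[OF D E \<rho>] y] continuous_on_slice[OF X_setD(2)[OF D E \<rho>'] y'])
  then have "\<bar>\<rho>' (x, y') / marginal D \<rho>' y' - \<rho> (x, y) / marginal D \<rho> y\<bar>
    \<le> \<eta> * (1 / \<delta> + B * measure lborel D / \<delta>\<^sup>2)"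
    using \<open>\<delta> > 0\<close> X_setD(4)[OF D E \<rho> y] X_setD(4)[OF D E \<rho>' y'] bound[OF x] close[OF x]
    by (intro abs_divide_diff_le)
  then show "\<bar>conditioning D (\<rho>, y) x - conditioning D (\<rho>', y') x\<bar>
    \<le> \<eta> * (1 / \<delta> + B * measure lborel D / \<delta>\<^sup>2)"
    using x by (simp add: conditioning_def cond_density_def abs_minus_commute)
qed

text \<open>The comparison passes through \<open>\<rho> (x, y')\<close>: the supremum distance
  controls the change of density, and uniform continuity of the fixed \<open>\<rho>\<close> controls
  the change of \<open>y\<close>. Hence \<open>d\<close> can be chosen before
  \<open>\<rho>'\<close>, \<open>y'\<close> and \<open>x\<close>.\<close>

lemma slices_uniformly_close:
  fixes D :: "'a::metric_space set" and E :: "'b::metric_space set"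
  assumes D: "compact D" and E: "compact E" and \<rho>: "\<rho> \<in> mspace (C_space (D \<times> E))"
    and y: "y \<in> E" and "\<eta> > 0"
  obtains d where "d > 0"
    "\<And>\<rho>' y' x. \<lbrakk>\<rho>' \<in> mspace (C_space (D \<times> E)); mdist (C_space (D \<times> E)) \<rho> \<rho>' < d;
      y' \<in> E; dist y y' < d; x \<in> D\<rbrakk> \<Longrightarrow> \<bar>\<rho>' (x, y') - \<rho> (x, y)\<bar> \<le> \<eta>"
proof -
  have comp: "compact (D \<times> E)"
    using D E by (rule compact_Times)
  then have "uniformly_continuous_on (D \<times> E) \<rho>"
    using \<rho> by (intro compact_uniformly_continuous) (auto simp: mspace_C_space)
  then obtain d where "d > 0" and
    d: "\<And>z z'. \<lbrakk>z \<in> D \<times> E; z' \<in> D \<times> E; dist z' z < d\<rbrakk> \<Longrightarrow> dist (\<rho> z') (\<rho> z) < \<eta> / 2"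
    using \<open>\<eta> > 0\<close> unfolding uniformly_continuous_on_def by (metis half_gt_zero)
  show thesis
  proof (rule that)
    \<comment> \<open>Each of the two changes may use up half of \<open>\<eta>\<close>.\<close>
    show "min d (\<eta> / 2) > 0"
      using \<open>d > 0\<close> \<open>\<eta> > 0\<close> by simp
    fix \<rho>' y' x
    assume \<rho>': "\<rho>' \<in> mspace (C_space (D \<times> E))"
      and dist\<rho>: "mdist (C_space (D \<times> E)) \<rho> \<rho>' < min d (\<eta> / 2)"
      and y': "y' \<in> E" and disty: "dist y y' < min d (\<eta> / 2)" and x: "x \<in> D"
    have "\<bar>\<rho> (x, y') - \<rho>' (x, y')\<bar> \<le> mdist (C_space (D \<times> E)) \<rho> \<rho>'"
      using comp \<rho> \<rho>' x y' by (intro abs_diff_le_mdist_C_space) auto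
    \<comment> \<open>The two points share their first coordinate, so their distance in the product
      is just \<open>dist y' y\<close>.\<close>
    moreover have "dist (\<rho> (x, y')) (\<rho> (x, y)) < \<eta> / 2"
      using d[of "(x, y)" "(x, y')"] x y y' disty by (simp add: dist_Pair_Pair dist_commute)
    ultimately show "\<bar>\<rho>' (x, y') - \<rho> (x, y)\<bar> \<le> \<eta>"
      using dist\<rho> unfolding dist_real_def by linarith
  qed
qed

lemma continuous_map_mtopology_of:
  "continuous_map (mtopology_of m) (mtopology_of m') f \<longleftrightarrow>
    f ` mspace m \<subseteq> mspace m' \<and>
    (\<forall>a\<in>mspace m. \<forall>\<epsilon>>0. \<exists>d>0. \<forall>x. x \<in> mspace m \<and> mdist m a x < d \<longrightarrow> mdist m' (f a) (f x) < \<epsilon>)"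
  unfolding mtopology_of_def
  by (rule Metric_space.metric_continuous_map[OF Metric_space_mspace_mdist Metric_space_mspace_mdist])

theorem theorem4p4:
  fixes D :: "(real ^ 'm) set" and E :: "(real ^ 'r) set" and \<delta> :: real
  assumes "compact D" and "lipschitz_boundary D"
    and "compact E" and "lipschitz_boundary E"
    and "\<delta> > 0"
  shows "continuous_map
     (mtopology_of (max_metric (submetric (C_space (D \<times> E)) (X_set D E \<delta>))
                               (submetric euclidean_metric E)))
     (mtopology_of (C_space D))
     (conditioning D)"
  unfolding continuous_map_mtopology_of
proof (intro conjI ballI allI impI)
  let ?m = "max_metric (submetric (C_space (D \<times> E)) (X_set D E \<delta>)) (submetric euclidean_metric E)"
  note D = \<open>compact D\<close> and E = \<open>compact E\<close>
  show "conditioning D ` mspace ?m \<subseteq> mspace (C_space D)"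
    using D E \<open>\<delta> > 0\<close> by (auto intro: conditioning_in_C_space)
  fix p and \<epsilon> :: real
  assume "p \<in> mspace ?m" and "\<epsilon> > 0"
  then obtain \<rho> y where p: "p = (\<rho>, y)" and \<rho>: "\<rho> \<in> X_set D E \<delta>" and y: "y \<in> E"
    by auto
  have "bounded (\<rho> ` (D \<times> E))"
    using D E X_setD(2)[OF D E \<rho>]
    by (intro compact_imp_bounded compact_continuous_image compact_Times)
  then obtain B where "B > 0" and B: "\<And>z. z \<in> D \<times> E \<Longrightarrow> \<bar>\<rho> z\<bar> \<le> B"
    unfolding bounded_pos by auto
  \<comment> \<open>\<open>K\<close> is the factor from \<open>mdist_conditioning_le\<close>, fixed
    once the base point is given.\<close>
  define K where "K = 1 / \<delta> + B * measure lborel D / \<delta>\<^sup>2"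
  have "K > 0"
    unfolding K_def using \<open>\<delta> > 0\<close> \<open>B > 0\<close> by (intro add_pos_nonneg) auto
  \<comment> \<open>The 2 makes \<open>\<eta> * K\<close> equal to half of
    \<open>\<epsilon>\<close>, so that the non-strict estimate yields a strict one.\<close>
  define \<eta> where "\<eta> = \<epsilon> / (2 * K)"
  have "\<eta> > 0" and \<eta>: "\<eta> * K < \<epsilon>"
    using \<open>K > 0\<close> \<open>\<epsilon> > 0\<close> by (auto simp: \<eta>_def field_simps)
  obtain d where "d > 0" and
    d: "\<And>\<rho>' y' x. \<lbrakk>\<rho>' \<in> mspace (C_space (D \<times> E)); mdist (C_space (D \<times> E)) \<rho> \<rho>' < d;
      y' \<in> E; dist y y' < d; x \<in> D\<rbrakk> \<Longrightarrow> \<bar>\<rho>' (x, y') - \<rho> (x, y)\<bar> \<le> \<eta>"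
    using slices_uniformly_close[OF D E X_setD(1)[OF D E \<rho>] y \<open>\<eta> > 0\<close>] by metis
  have "mdist (C_space D) (conditioning D p) (conditioning D q) < \<epsilon>"
    if q_mem: "q \<in> mspace ?m" and q_dist: "mdist ?m p q < d" for q
  proof -
    obtain \<rho>' y' where q: "q = (\<rho>', y')" and \<rho>': "\<rho>' \<in> X_set D E \<delta>" and y': "y' \<in> E"
      using q_mem by auto
    have "mdist (C_space (D \<times> E)) \<rho> \<rho>' < d" "dist y y' < d"
      using q_dist by (auto simp: p q)
    then have "mdist (C_space D) (conditioning D (\<rho>, y)) (conditioning D (\<rho>', y')) \<le> \<eta> * K"
      unfolding K_def using D E \<open>\<delta> > 0\<close> \<rho> \<rho>' y y' B d X_setD(1)[OF D E \<rho>']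
      by (intro mdist_conditioning_le) auto
    then show ?thesis
      using \<eta> by (simp add: p q)
  qed
  then show "\<exists>d>0. \<forall>q. q \<in> mspace ?m \<and> mdist ?m p q < d \<longrightarrow>
      mdist (C_space D) (conditioning D p) (conditioning D q) < \<epsilon>"
    using \<open>d > 0\<close> by blast
qed

end
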